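(* Let $G$ be a finite planar trivalent graph containing three edges which form a triangle, and let $G'$ be the graph obtained from $G$ by collapsing the triangle to a single vertex. Then $\mathcal{M}(G)\cong\mathcal{M}(G')$ (homeomorphic).
   Context: Graphs are finite; multiple edges are allowed, and closed circle components without vertices are allowed (such a circle counts as a single edge with no vertices). Trivalent means that every vertex has exactly three incident edge-ends. A decoration of $G$ assigns to each edge $e\in E(G)$ a point $D(e)\in\mathbb{CP}^2$, i.e. a complex line through the origin in $\mathbb{C}^3$. It is admissible if at every vertex the three lines attached to the three incident edge-ends are pairwise orthogonal in $\mathbb{C}^3$ with respect to the standard Hermitian inner product (so a graph with an edge having both ends at the same vertex has no admissible decorations). $\mathcal{M}(G)$ is the set of admissible decorations with the subspace topology from $\prod_{e\in E(G)}\mathbb{CP}^2$. A triangle consists of three distinct vertices pairwise joined by three edges $d,e,f$; each of the three vertices has one further incident edge-end, belonging to edges $a,b,c$ respectively. Collapsing the triangle means removing $d,e,f$ and identifying the three vertices to one vertex, whose three incident edge-ends are those of $a,b,c$. *)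

theory Defs
  imports "HOL-Analysis.Analysis"
begin

section \<open>Finite multigraphs with circle components\<close>

text \<open>
  An edge \<open>e\<close> outside \<open>circles\<close> has exactly two edge-ends, \<open>(e, False)\<close> and \<open>(e, True)\<close>;
  the end \<open>(e, i)\<close> is attached to the vertex \<open>endpt G e i\<close>.  The labels \<open>False\<close> and \<open>True\<close> only
  tell the two ends of an edge apart.  An edge in \<open>circles\<close> is a closed circle component without
  vertices; for it \<open>endpt\<close> carries no information.
\<close>

record ('v, 'e) multigraph =
  verts :: "'v set"
  edges :: "'e set"
  circles :: "'e set"
  endpt :: "'e \<Rightarrow> bool \<Rightarrow> 'v"

definition finite_multigraph :: "('v, 'e) multigraph \<Rightarrow> bool" where
  "finite_multigraph G \<longleftrightarrow>
     finite (verts G) \<and> finite (edges G) \<and> circles G \<subseteq> edges G \<and>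
     (\<forall>e \<in> edges G - circles G. \<forall>i. endpt G e i \<in> verts G)"

definition ends_at :: "('v, 'e) multigraph \<Rightarrow> 'v \<Rightarrow> ('e \<times> bool) set" where
  "ends_at G v = {(e, i). e \<in> edges G - circles G \<and> endpt G e i = v}"

definition trivalent :: "('v, 'e) multigraph \<Rightarrow> bool" where
  "trivalent G \<longleftrightarrow> (\<forall>v \<in> verts G. card (ends_at G v) = 3)"

definition endpoints :: "('v, 'e) multigraph \<Rightarrow> 'e \<Rightarrow> 'v set" where
  "endpoints G e = (if e \<in> circles G then {} else {endpt G e False, endpt G e True})"

text \<open>
  Recall that \<open>simple_path\<close> admits simple closed paths.  So, below, an edge with two distinct
  endpoints is drawn as an arc, an edge with both ends at one vertex as a simple closed curve
  through that vertex, and a circle component as a simple closed curve avoiding all vertices.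
\<close>

definition plane_drawing ::
  "('v, 'e) multigraph \<Rightarrow> ('v \<Rightarrow> real ^ 2) \<Rightarrow> ('e \<Rightarrow> real \<Rightarrow> real ^ 2) \<Rightarrow> bool" where
  "plane_drawing G p \<gamma> \<longleftrightarrow>
     inj_on p (verts G) \<and>
     (\<forall>e \<in> edges G. simple_path (\<gamma> e)) \<and>
     (\<forall>e \<in> edges G - circles G.
        pathstart (\<gamma> e) = p (endpt G e False) \<and> pathfinish (\<gamma> e) = p (endpt G e True)) \<and>
     (\<forall>e \<in> circles G. pathstart (\<gamma> e) = pathfinish (\<gamma> e)) \<and>
     (\<forall>e \<in> edges G. path_image (\<gamma> e) \<inter> p ` verts G = p ` endpoints G e) \<and>
     (\<forall>e \<in> edges G. \<forall>e' \<in> edges G. e \<noteq> e' \<longrightarrow>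
        path_image (\<gamma> e) \<inter> path_image (\<gamma> e') \<subseteq> p ` verts G)"

definition planar :: "('v, 'e) multigraph \<Rightarrow> bool" where
  "planar G \<longleftrightarrow> (\<exists>p \<gamma>. plane_drawing G p \<gamma>)"

section \<open>Triangles and their collapse\<close>

text \<open>
  The edge \<open>d\<close> lies opposite to the vertex \<open>x\<close>, \<open>e\<close> opposite to \<open>y\<close>, and \<open>f\<close> opposite to \<open>z\<close>.
\<close>

definition forms_triangle ::
  "('v, 'e) multigraph \<Rightarrow> 'v \<Rightarrow> 'v \<Rightarrow> 'v \<Rightarrow> 'e \<Rightarrow> 'e \<Rightarrow> 'e \<Rightarrow> bool" where
  "forms_triangle G x y z d e f \<longleftrightarrow>
     {x, y, z} \<subseteq> verts G \<and> x \<noteq> y \<and> y \<noteq> z \<and> x \<noteq> z \<and>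
     {d, e, f} \<subseteq> edges G - circles G \<and>
     endpoints G d = {y, z} \<and> endpoints G e = {x, z} \<and> endpoints G f = {x, y}"

text \<open>
  The vertex obtained by identifying \<open>x\<close>, \<open>y\<close> and \<open>z\<close> is named \<open>x\<close>.
\<close>

definition collapse ::
  "('v, 'e) multigraph \<Rightarrow> 'v \<Rightarrow> 'v \<Rightarrow> 'v \<Rightarrow> 'e \<Rightarrow> 'e \<Rightarrow> 'e \<Rightarrow> ('v, 'e) multigraph" where
  "collapse G x y z d e f =
     \<lparr>verts = verts G - {y, z},
      edges = edges G - {d, e, f},
      circles = circles G,
      endpt = (\<lambda>a i. if endpt G a i \<in> {x, y, z} then x else endpt G a i)\<rparr>"

section \<open>The complex projective plane\<close>

text \<open>
  The operations prefixed by \<open>vec\<close> refer to scalar multiplication \<open>(*s)\<close> over the field of the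
  components, so \<open>vec.subspace\<close>, \<open>vec.dim\<close> and \<open>vec.span\<close> are complex-linear here, in contrast to
  the real-linear \<open>subspace\<close>, \<open>dim\<close> and \<open>span\<close>.
\<close>

definition CP2_points :: "(complex ^ 3) set set" where
  "CP2_points = {L. vec.subspace L \<and> vec.dim L = 1}"

text \<open>The quotient topology with respect to \<open>v \<mapsto> \<complex>v\<close> on the nonzero vectors.\<close>

definition CP2 :: "(complex ^ 3) set topology" where
  "CP2 = topology (\<lambda>U. U \<subseteq> CP2_points \<and> open {v. v \<noteq> 0 \<and> vec.span {v} \<in> U})"

lemma openin_CP2:
  "openin CP2 U \<longleftrightarrow> U \<subseteq> CP2_points \<and> open {v. v \<noteq> 0 \<and> vec.span {v} \<in> U}"
proof -
  have "istopology (\<lambda>U. U \<subseteq> CP2_points \<and> open {v. v \<noteq> 0 \<and> vec.span {v} \<in> U})"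
    unfolding istopology_def
  proof (intro conjI allI impI; (elim conjE)?)
    fix S T :: "(complex ^ 3) set set"
    assume "open {v. v \<noteq> 0 \<and> vec.span {v} \<in> S}" "open {v. v \<noteq> 0 \<and> vec.span {v} \<in> T}"
    then have "open ({v. v \<noteq> 0 \<and> vec.span {v} \<in> S} \<inter> {v. v \<noteq> 0 \<and> vec.span {v} \<in> T})"
      by (rule open_Int)
    then show "open {v. v \<noteq> 0 \<and> vec.span {v} \<in> S \<inter> T}"
      by (rule back_subst[of "open"]) auto
  next
    fix \<K> :: "(complex ^ 3) set set set"
    assume *: "\<forall>K\<in>\<K>. K \<subseteq> CP2_points \<and> open {v. v \<noteq> 0 \<and> vec.span {v} \<in> K}"
    then have "open (\<Union>K\<in>\<K>. {v. v \<noteq> 0 \<and> vec.span {v} \<in> K})"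
      by blast
    then show "open {v. v \<noteq> 0 \<and> vec.span {v} \<in> \<Union>\<K>}"
      by (rule back_subst[of "open"]) auto
  qed blast+
  then show ?thesis
    unfolding CP2_def by simp
qed

lemma span_singleton_in_CP2_points:
  fixes v :: "complex ^ 3"
  assumes "v \<noteq> 0"
  shows "vec.span {v} \<in> CP2_points"
  using assms vec.dim_span[of "{v}"] vec.dim_singleton[of v]
  by (simp add: CP2_points_def)

lemma topspace_CP2 [simp]: "topspace CP2 = CP2_points"
proof -
  have "{v :: complex ^ 3. v \<noteq> 0 \<and> vec.span {v} \<in> CP2_points} = - {0}"
    by (auto simp: span_singleton_in_CP2_points)
  then have "openin CP2 CP2_points"
    by (simp add: openin_CP2 open_Compl)
  then show ?thesis
    by (metis openin_CP2 openin_subset openin_topspace subset_antisym)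
qed

section \<open>Admissible decorations\<close>

definition hermitian :: "complex ^ 'n \<Rightarrow> complex ^ 'n \<Rightarrow> complex" where
  "hermitian u v = (\<Sum>i\<in>UNIV. u $ i * cnj (v $ i))"

definition orthogonal_lines :: "(complex ^ 3) set \<Rightarrow> (complex ^ 3) set \<Rightarrow> bool" where
  "orthogonal_lines L M \<longleftrightarrow> (\<forall>u \<in> L. \<forall>v \<in> M. hermitian u v = 0)"

text \<open>
  Orthogonality is required for distinct edge-ends rather than distinct edges, so that an edge with
  both ends at the same vertex would need a line orthogonal to itself.
\<close>

definition admissible :: "('v, 'e) multigraph \<Rightarrow> ('e \<Rightarrow> (complex ^ 3) set) \<Rightarrow> bool" where
  "admissible G D \<longleftrightarrow>
     (\<forall>v \<in> verts G. \<forall>h \<in> ends_at G v. \<forall>k \<in> ends_at G v.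
        h \<noteq> k \<longrightarrow> orthogonal_lines (D (fst h)) (D (fst k)))"

definition decoration_space :: "('v, 'e) multigraph \<Rightarrow> ('e \<Rightarrow> (complex ^ 3) set) topology" where
  "decoration_space G =
     subtopology (product_topology (\<lambda>_. CP2) (edges G)) {D. admissible G D}"

end

theory Submission
  imports Defs
begin

text \<open>
  In an admissible decoration the lines of the triangle edges \<open>d\<close>, \<open>e\<close>, \<open>f\<close> are pairwise orthogonal,
  since any two of these edges share a vertex. As they form an orthogonal frame of \<open>\<complex>\<^sup>3\<close>, the third
  line at \<open>x\<close>, being orthogonal to those of \<open>e\<close> and \<open>f\<close>, is the line of \<open>d\<close>; likewise at \<open>y\<close> and \<open>z\<close>.
  Hence a decoration of \<open>G\<close> is determined by its restriction to the collapsed graph, and conversely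
  the three lines at the collapsed vertex can be copied onto the opposite triangle edges. Both maps
  are continuous because each of their components is a coordinate projection.
\<close>

section \<open>The Hermitian form and orthogonal frames in complex 3-space\<close>

lemma hermitian_commute: "hermitian v u = cnj (hermitian u v)"
  by (simp add: hermitian_def mult.commute)

lemma hermitian_commute_eq_0: "hermitian u v = 0 \<Longrightarrow> hermitian v u = 0"
  by (simp add: hermitian_commute[of v u])

lemma hermitian_self_eq_0_iff: "hermitian u u = 0 \<longleftrightarrow> u = 0"
proof
  assume "hermitian u u = 0"
  then have "(\<Sum>i\<in>UNIV. complex_of_real ((norm (u $ i))\<^sup>2)) = 0"
    by (simp add: hermitian_def complex_norm_square del: of_real_power)
  then have "(\<Sum>i\<in>UNIV. (norm (u $ i))\<^sup>2) = 0"
    by (metis of_real_eq_0_iff of_real_sum)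
  then show "u = 0"
    by (simp add: sum_nonneg_eq_0_iff vec_eq_iff)
qed (simp add: hermitian_def)

lemma subspace_hermitian_left: "vec.subspace {v. hermitian v u = 0}"
  by (auto simp: vec.subspace_def hermitian_def distrib_right sum.distrib mult.assoc
      simp flip: sum_distrib_left)

lemma hermitian_span_left:
  assumes "\<And>v. v \<in> S \<Longrightarrow> hermitian v u = 0" and "w \<in> vec.span S"
  shows "hermitian w u = 0"
  using vec.span_minimal[OF _ subspace_hermitian_left, of S u] assms by auto

lemma hermitian_diff_scale_left:
  "hermitian (p - k *s u) v = hermitian p v - k * hermitian u v"
  by (simp add: hermitian_def left_diff_distrib sum_subtractf sum_distrib_left mult.assoc)

text \<open>Nonzero pairwise orthogonal vectors are independent, so \<open>u\<close>,
  \<open>v\<close>, \<open>w\<close> span the whole space. Removing the \<open>u\<close>-component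
  of \<open>p\<close> leaves a vector in the span of \<open>v\<close> and \<open>w\<close> that is
  also orthogonal to both, hence to itself; definiteness makes it zero.\<close>

lemma orthogonal_to_two_of_frame:
  fixes u v w p :: "complex ^ 3"
  assumes nz: "u \<noteq> 0" "v \<noteq> 0" "w \<noteq> 0"
    and uv: "hermitian u v = 0" and uw: "hermitian u w = 0" and vw: "hermitian v w = 0"
    and pv: "hermitian p v = 0" and pw: "hermitian p w = 0"
  shows "\<exists>k. p = k *s u"
proof -
  have vu: "hermitian v u = 0" and wu: "hermitian w u = 0" and wv: "hermitian w v = 0"
    using uv uw vw hermitian_commute_eq_0 by blast+
  \<comment> \<open>Were \<open>u\<close> in this span, it would be orthogonal to itself.\<close>
  have u_notin: "u \<notin> vec.span {v, w}"
    using hermitian_span_left[of "{v, w}" u u] vu wu nz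
    by (metis empty_iff hermitian_self_eq_0_iff insert_iff)
  have v_notin: "v \<notin> vec.span {w}"
    using hermitian_span_left[of "{w}" v v] wv nz
    by (metis empty_iff hermitian_self_eq_0_iff insert_iff)
  have neq: "u \<noteq> v" "u \<noteq> w" "v \<noteq> w"
    using uv uw vw nz hermitian_self_eq_0_iff by metis+
  have "vec.independent {u, v, w}"
    using u_notin v_notin nz by (simp add: vec.independent_insert)
  then have "UNIV \<subseteq> vec.span {u, v, w}"
    using neq by (intro vec.card_ge_dim_independent) (simp_all add: card_cart_basis)
  then obtain k where k: "p - k *s u \<in> vec.span {v, w}"
    using vec.span_breakdown_eq[of p u "{v, w}"] by blast
  let ?q = "p - k *s u"
  have "hermitian ?q v = 0" "hermitian ?q w = 0"
    by (simp_all add: hermitian_diff_scale_left pv pw uv uw)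
  then have "hermitian v ?q = 0" "hermitian w ?q = 0"
    using hermitian_commute_eq_0 by blast+
  then have "hermitian ?q ?q = 0"
    using hermitian_span_left[OF _ k, of ?q] by blast
  then have "?q = 0"
    by (simp only: hermitian_self_eq_0_iff)
  then show ?thesis
    by (simp only: right_minus_eq) blast
qed

section \<open>Points of the projective plane and their orthogonality\<close>

lemma CP2_points_obtain_span:
  assumes "L \<in> CP2_points"
  obtains u where "u \<noteq> 0" "L = vec.span {u}"
proof -
  have L: "vec.subspace L" "vec.dim L = 1"
    using assms by (auto simp: CP2_points_def)
  obtain B where B: "B \<subseteq> L" "vec.independent B" "L \<subseteq> vec.span B" "card B = vec.dim L"
    using vec.basis_exists by blast
  then obtain u where u: "B = {u}"
    using L by (metis card_1_singletonE)
  have "L = vec.span {u}"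
    using B L u vec.span_minimal by blast
  moreover have "u \<noteq> 0"
    using B u by (metis vec.dependent_zero singletonI)
  ultimately show ?thesis
    using that by blast
qed

lemma orthogonal_lines_sym: "orthogonal_lines L M \<longleftrightarrow> orthogonal_lines M L"
  unfolding orthogonal_lines_def using hermitian_commute_eq_0 by blast

text \<open>On spanning vectors the frame argument gives \<open>P \<subseteq> L\<close>; both have
  dimension one, so they coincide.\<close>

lemma orthogonal_lines_frame_unique:
  assumes pts: "L \<in> CP2_points" "M \<in> CP2_points" "N \<in> CP2_points" "P \<in> CP2_points"
    and "orthogonal_lines L M" "orthogonal_lines L N" "orthogonal_lines M N"
    and "orthogonal_lines P M" "orthogonal_lines P N"
  shows "P = L"
proof -
  obtain u v w p where u: "u \<noteq> 0" "L = vec.span {u}" and v: "v \<noteq> 0" "M = vec.span {v}"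
    and w: "w \<noteq> 0" "N = vec.span {w}" and p: "p \<noteq> 0" "P = vec.span {p}"
    using pts[THEN CP2_points_obtain_span] by metis
  have "u \<in> L" "v \<in> M" "w \<in> N" "p \<in> P"
    using u v w p by (simp_all add: vec.span_base)
  then obtain k where k: "p = k *s u"
    using orthogonal_to_two_of_frame[of u v w p] assms u v w
    by (auto simp: orthogonal_lines_def)
  then have "P \<subseteq> L"
    using p u by (intro vec.span_minimal[of "{p}" L, folded p(2)])
      (auto simp: vec.span_scale vec.span_base)
  then show ?thesis
    using vec.subspace_dim_equal[of P L] pts by (simp add: CP2_points_def)
qed

section \<open>Edge-ends and admissibility around a triangle\<close>

lemma orthogonal_ends_iff:
  assumes "ends_at G v = {h, k, l}" "h \<noteq> k" "h \<noteq> l" "k \<noteq> l"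
  shows "(\<forall>a \<in> ends_at G v. \<forall>b \<in> ends_at G v.
            a \<noteq> b \<longrightarrow> orthogonal_lines (D (fst a)) (D (fst b))) \<longleftrightarrow>
         orthogonal_lines (D (fst h)) (D (fst k)) \<and>
         orthogonal_lines (D (fst h)) (D (fst l)) \<and>
         orthogonal_lines (D (fst k)) (D (fst l))"
  unfolding assms(1) using assms(2-4)
  by (simp add: assms(2-4)[symmetric]) (metis orthogonal_lines_sym)

text \<open>Every edge-end belongs to an edge of \<open>G\<close>, so admissibility does not see
  values elsewhere. This allows passing to restrictions of \<open>D\<close>.\<close>

lemma admissible_cong:
  assumes "\<And>u. u \<in> edges G \<Longrightarrow> D u = D' u"
  shows "admissible G D \<longleftrightarrow> admissible G D'"
proof -
  have "D (fst h) = D' (fst h)" if "h \<in> ends_at G v" for h v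
    using that assms by (auto simp: ends_at_def)
  then show ?thesis
    by (simp add: admissible_def)
qed

text \<open>Neither \<open>g\<close> nor \<open>g'\<close> is a loop, so each uses up exactly one of
  the three ends at \<open>v\<close>, and one end \<open>h\<close> remains.\<close>

lemma third_end:
  assumes "trivalent G" "v \<in> verts G" "g \<in> edges G - circles G" "g' \<in> edges G - circles G"
    and gs: "endpoints G g = {v, s}" "endpoints G g' = {v, t}" and neq: "v \<noteq> s" "v \<noteq> t" "s \<noteq> t"
  obtains i j h where "ends_at G v = {h, (g, i), (g', j)}" "g \<noteq> g'" "fst h \<noteq> g" "fst h \<noteq> g'"
proof -
  have "g \<noteq> g'"
    using gs neq by (auto simp: doubleton_eq_iff)
  have end_unique: "\<exists>i. endpt G k i = v \<and> endpt G k (\<not> i) \<noteq> v"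
    if "k \<in> edges G - circles G" "endpoints G k = {v, r}" "v \<noteq> r" for k r
  proof -
    have "endpt G k False = v \<and> endpt G k True = r \<or> endpt G k False = r \<and> endpt G k True = v"
      using that(1,2) by (simp add: endpoints_def doubleton_eq_iff)
    then show ?thesis
      using that(3) by (metis (full_types))
  qed
  obtain i where i: "endpt G g i = v" "endpt G g (\<not> i) \<noteq> v"
    using end_unique assms by blast
  obtain j where j: "endpt G g' j = v" "endpt G g' (\<not> j) \<noteq> v"
    using end_unique assms by blast
  have card3: "card (ends_at G v) = 3"
    using assms by (auto simp: trivalent_def)
  have sub: "{(g, i), (g', j)} \<subseteq> ends_at G v"
    using i j assms by (auto simp: ends_at_def)
  have "card (ends_at G v - {(g, i), (g', j)}) = 1"
    using card_Diff_subset[OF _ sub] card3 \<open>g \<noteq> g'\<close> by simp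
  then obtain h where h: "ends_at G v - {(g, i), (g', j)} = {h}"
    by (metis card_1_singletonE)
  then have "h \<in> ends_at G v - {(g, i), (g', j)}"
    by blast
  then have "endpt G (fst h) (snd h) = v" "h \<noteq> (g, i)" "h \<noteq> (g', j)"
    by (auto simp: ends_at_def)
  \<comment> \<open>An end on \<open>g\<close> other than \<open>(g, i)\<close> is
    \<open>(g, \<not> i)\<close>, which is not attached to \<open>v\<close>; likewise for
    \<open>g'\<close>.\<close>
  then have "fst h \<noteq> g" "fst h \<noteq> g'"
    using i j by (cases h; cases "snd h"; cases i; cases j; auto)+
  then show ?thesis
    using that[of h i j] sub h \<open>g \<noteq> g'\<close> by blast
qed

text \<open>Here \<open>a\<close>, \<open>b\<close>, \<open>c\<close> are the outer edges at
  \<open>x\<close>, \<open>y\<close>, \<open>z\<close>; they may coincide. Collapsing keeps the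
  names of the remaining edges, so the same \<open>D\<close> can be tested on both graphs.\<close>

lemma admissible_collapse_iff:
  fixes G :: "('v, 'e) multigraph"
  assumes "trivalent G" and tri: "forms_triangle G x y z d e f"
  obtains a b c where "{a, b, c} \<subseteq> edges G - {d, e, f}"
    and "\<And>D. D \<in> edges G \<rightarrow> CP2_points \<Longrightarrow>
           admissible G D \<longleftrightarrow>
           D d = D a \<and> D e = D b \<and> D f = D c \<and> admissible (collapse G x y z d e f) D"
    and "d \<noteq> e" "d \<noteq> f" "e \<noteq> f"
proof -
  let ?H = "collapse G x y z d e f"
  have V: "x \<in> verts G" "y \<in> verts G" "z \<in> verts G" and neq: "x \<noteq> y" "y \<noteq> z" "x \<noteq> z"
    and E: "d \<in> edges G - circles G" "e \<in> edges G - circles G" "f \<in> edges G - circles G"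
    and ep: "endpoints G d = {y, z}" "endpoints G e = {x, z}" "endpoints G f = {x, y}"
    and ep': "endpoints G d = {z, y}" "endpoints G e = {z, x}" "endpoints G f = {y, x}"
    using tri by (auto simp: forms_triangle_def)
  obtain ix jx hx where x: "ends_at G x = {hx, (e, ix), (f, jx)}"
      "e \<noteq> f" "fst hx \<noteq> e" "fst hx \<noteq> f"
    using third_end[OF assms(1) V(1) E(2,3) ep(2,3)] neq by metis
  obtain iy jy hy where y: "ends_at G y = {hy, (d, iy), (f, jy)}"
      "d \<noteq> f" "fst hy \<noteq> d" "fst hy \<noteq> f"
    using third_end[OF assms(1) V(2) E(1,3) ep(1) ep'(3)] neq by metis
  obtain iz jz hz where z: "ends_at G z = {hz, (d, iz), (e, jz)}"
      "d \<noteq> e" "fst hz \<noteq> d" "fst hz \<noteq> e"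
    using third_end[OF assms(1) V(3) E(1,2) ep'(1,2)] neq by metis
  have end_pt: "h \<in> ends_at G v \<Longrightarrow>
      fst h \<in> edges G - circles G \<and> endpt G (fst h) (snd h) = v \<and> v \<in> endpoints G (fst h)" for h v
    by (cases h; cases "snd h") (auto simp: ends_at_def endpoints_def)
  have hx: "fst hx \<in> edges G - circles G" "endpt G (fst hx) (snd hx) = x" "x \<in> endpoints G (fst hx)"
    and hy: "fst hy \<in> edges G - circles G" "endpt G (fst hy) (snd hy) = y" "y \<in> endpoints G (fst hy)"
    and hz: "fst hz \<in> edges G - circles G" "endpt G (fst hz) (snd hz) = z" "z \<in> endpoints G (fst hz)"
    using end_pt[of hx x] end_pt[of hy y] end_pt[of hz z] x(1) y(1) z(1) by simp_all
  \<comment> \<open>The edge opposite to a triangle vertex does not touch it, so the outer edges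
    avoid all of \<open>d\<close>, \<open>e\<close>, \<open>f\<close>.\<close>
  have out: "fst hx \<noteq> d" "fst hy \<noteq> e" "fst hz \<noteq> f"
    using hx hy hz ep neq by auto
  \<comment> \<open>The outer ends are distinct, being attached to different vertices, even when two
    of them lie on one edge.\<close>
  have hneq: "hx \<noteq> hy" "hx \<noteq> hz" "hy \<noteq> hz"
    using hx hy hz neq by auto
  have "ends_at ?H x = (ends_at G x \<union> ends_at G y \<union> ends_at G z) - {d, e, f} \<times> UNIV"
    by (auto simp: ends_at_def collapse_def)
  also have "\<dots> = {hx, hy, hz}"
    using x y z out by (auto simp: mem_Times_iff)
  finally have endsH: "ends_at ?H x = {hx, hy, hz}" .
  have ends_other: "ends_at ?H v = ends_at G v" if "v \<notin> {x, y, z}" for v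
  proof -
    have "k \<notin> {d, e, f}" if "(k, i) \<in> ends_at G v" for k i
      using end_pt[OF that] ep \<open>v \<notin> {x, y, z}\<close> by auto
    then show ?thesis
      using that by (fastforce simp: ends_at_def collapse_def)
  qed
  \<comment> \<open>\<open>orth K v D\<close> is the admissibility condition at the single vertex
    \<open>v\<close>, so that the vertices off the triangle can be split off as
    \<open>?rest\<close>.\<close>
  define orth where "orth = (\<lambda>(K :: ('v, 'e) multigraph) v (D :: 'e \<Rightarrow> (complex ^ 3) set).
    \<forall>h \<in> ends_at K v. \<forall>k \<in> ends_at K v. h \<noteq> k \<longrightarrow> orthogonal_lines (D (fst h)) (D (fst k)))"
  have adm: "admissible K D \<longleftrightarrow> (\<forall>v \<in> verts K. orth K v D)" for D and K :: "('v, 'e) multigraph"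
    by (simp add: admissible_def orth_def)
  let ?rest = "\<lambda>D. \<forall>v \<in> verts G - {x, y, z}. orth G v D"
  have admG: "admissible G D \<longleftrightarrow> orth G x D \<and> orth G y D \<and> orth G z D \<and> ?rest D" for D
    using V by (auto simp: adm)
  have admH: "admissible ?H D \<longleftrightarrow> orth ?H x D \<and> ?rest D" for D
  proof -
    have "verts ?H = insert x (verts G - {x, y, z})"
      using V neq by (auto simp: collapse_def)
    moreover have "orth ?H v D = orth G v D" if "v \<notin> {x, y, z}" for v
      by (simp add: orth_def ends_other[OF that])
    ultimately show ?thesis
      by (auto simp: adm)
  qed
  let ?a = "fst hx" and ?b = "fst hy" and ?c = "fst hz"
  have ox: "orth G x D \<longleftrightarrow> orthogonal_lines (D ?a) (D e) \<and> orthogonal_lines (D ?a) (D f) \<and>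
      orthogonal_lines (D e) (D f)" for D
  proof -
    have "hx \<noteq> (e, ix)" "hx \<noteq> (f, jx)" "(e, ix) \<noteq> (f, jx)"
      using x(2-4) by auto
    from orthogonal_ends_iff[OF x(1) this, of D] show ?thesis
      by (simp only: orth_def fst_conv)
  qed
  have oy: "orth G y D \<longleftrightarrow> orthogonal_lines (D ?b) (D d) \<and> orthogonal_lines (D ?b) (D f) \<and>
      orthogonal_lines (D d) (D f)" for D
  proof -
    have "hy \<noteq> (d, iy)" "hy \<noteq> (f, jy)" "(d, iy) \<noteq> (f, jy)"
      using y(2-4) by auto
    from orthogonal_ends_iff[OF y(1) this, of D] show ?thesis
      by (simp only: orth_def fst_conv)
  qed
  have oz: "orth G z D \<longleftrightarrow> orthogonal_lines (D ?c) (D d) \<and> orthogonal_lines (D ?c) (D e) \<and>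
      orthogonal_lines (D d) (D e)" for D
  proof -
    have "hz \<noteq> (d, iz)" "hz \<noteq> (e, jz)" "(d, iz) \<noteq> (e, jz)"
      using z(2-4) by auto
    from orthogonal_ends_iff[OF z(1) this, of D] show ?thesis
      by (simp only: orth_def fst_conv)
  qed
  have oH: "orth ?H x D \<longleftrightarrow> orthogonal_lines (D ?a) (D ?b) \<and> orthogonal_lines (D ?a) (D ?c) \<and>
      orthogonal_lines (D ?b) (D ?c)" for D
    by (simp only: orth_def orthogonal_ends_iff[OF endsH hneq])
  show ?thesis
  proof (rule that[of ?a ?b ?c])
    show "{?a, ?b, ?c} \<subseteq> edges G - {d, e, f}"
      using x y z out hx hy hz by auto
    fix D :: "'e \<Rightarrow> (complex ^ 3) set"
    assume D: "D \<in> edges G \<rightarrow> CP2_points"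
    have pts: "D d \<in> CP2_points" "D e \<in> CP2_points" "D f \<in> CP2_points"
        "D ?a \<in> CP2_points" "D ?b \<in> CP2_points" "D ?c \<in> CP2_points"
      using D E hx hy hz by auto
    have "D d = D ?a \<and> D e = D ?b \<and> D f = D ?c" if "orth G x D" "orth G y D" "orth G z D"
    proof -
      \<comment> \<open>The pairs \<open>e\<close>, \<open>f\<close> at \<open>x\<close>,
        \<open>d\<close>, \<open>f\<close> at \<open>y\<close> and \<open>d\<close>,
        \<open>e\<close> at \<open>z\<close> supply the frame, which is then used once for each of
        its members.\<close>
      note o = that[unfolded ox oy oz]
      then have "orthogonal_lines (D e) (D d)" "orthogonal_lines (D f) (D d)"
          "orthogonal_lines (D f) (D e)"
        by (simp_all add: orthogonal_lines_sym[of "D e" "D d"] orthogonal_lines_sym[of "D f"])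
      with o show ?thesis
        using orthogonal_lines_frame_unique[OF pts(1,2,3,4)]
          orthogonal_lines_frame_unique[OF pts(2,1,3,5)]
          orthogonal_lines_frame_unique[OF pts(3,1,2,6)] by simp
    qed
    \<comment> \<open>After substituting the equalities, the condition at each triangle vertex says
      that the lines of \<open>?a\<close>, \<open>?b\<close>, \<open>?c\<close> are pairwise
      orthogonal, which is the condition at the merged vertex.\<close>
    moreover have "orth G x D \<and> orth G y D \<and> orth G z D \<longleftrightarrow> orth ?H x D"
      if "D d = D ?a" "D e = D ?b" "D f = D ?c"
      unfolding ox oy oz oH that using orthogonal_lines_sym[of "D ?b" "D ?a"]
        orthogonal_lines_sym[of "D ?c" "D ?a"] orthogonal_lines_sym[of "D ?c" "D ?b"] by blast
    ultimately show "admissible G D \<longleftrightarrow>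
        D d = D ?a \<and> D e = D ?b \<and> D f = D ?c \<and> admissible ?H D"
      unfolding admG admH by blast
  qed (use x y z in auto)
qed

section \<open>The homeomorphism of decoration spaces\<close>

theorem lemma3:
  fixes G :: "('v, 'e) multigraph"
    and x y z :: 'v and d e f :: 'e
  assumes "finite_multigraph G"
    and "planar G"
    and "trivalent G"
    and "forms_triangle G x y z d e f"
  shows "decoration_space G homeomorphic_space decoration_space (collapse G x y z d e f)"
proof -
  let ?H = "collapse G x y z d e f"
  obtain a b c where abc: "{a, b, c} \<subseteq> edges G - {d, e, f}"
    and adm: "\<And>D. D \<in> edges G \<rightarrow> CP2_points \<Longrightarrow>
           admissible G D \<longleftrightarrow> D d = D a \<and> D e = D b \<and> D f = D c \<and> admissible ?H D"
    and neq: "d \<noteq> e" "d \<noteq> f" "e \<noteq> f"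
    using admissible_collapse_iff[OF assms(3,4)] by metis
  have edgesH: "edges ?H = edges G - {d, e, f}"
    by (simp add: collapse_def)
  have def_in: "d \<in> edges G" "e \<in> edges G" "f \<in> edges G"
    using assms(4) by (auto simp: forms_triangle_def)
  have topspace: "topspace (decoration_space K) = {D \<in> edges K \<rightarrow>\<^sub>E CP2_points. admissible K D}"
    for K :: "('v, 'e) multigraph"
    by (auto simp: decoration_space_def)
  have proj: "continuous_map (decoration_space K) CP2 (\<lambda>D. D u)" if "u \<in> edges K"
    for u and K :: "('v, 'e) multigraph"
    unfolding decoration_space_def
    by (intro continuous_map_from_subtopology continuous_map_product_projection that)
  \<comment> \<open>Continuity into a product is checked componentwise; the second premise supplies
    admissibility and extensionality.\<close>
  have into: "continuous_map X (decoration_space K) g"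
    if "\<And>u. u \<in> edges K \<Longrightarrow> continuous_map X CP2 (\<lambda>D. g D u)"
      "g \<in> topspace X \<rightarrow> topspace (decoration_space K)"
    for X :: "('e \<Rightarrow> (complex ^ 3) set) topology" and K :: "('v, 'e) multigraph" and g
    unfolding decoration_space_def continuous_map_in_subtopology continuous_map_componentwise
    using that by (auto simp: topspace Pi_iff PiE_iff)

  define r where "r = (\<lambda>D :: 'e \<Rightarrow> (complex ^ 3) set. restrict D (edges ?H))"
  \<comment> \<open>\<open>copy\<close> sends each edge of \<open>G\<close> to the edge of
    \<open>?H\<close> whose line it receives, so \<open>s\<close> is pullback along
    \<open>copy\<close>. The restriction makes the result \<open>undefined\<close> off the edges, as
    points of the product must be.\<close>
  define copy where "copy = (\<lambda>u. if u = d then a else if u = e then b else if u = f then c else u)"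
  define s where "s = (\<lambda>D :: 'e \<Rightarrow> (complex ^ 3) set. restrict (D \<circ> copy) (edges G))"
  have copy_in: "copy u \<in> edges ?H" if "u \<in> edges G" for u
    using that abc by (auto simp: copy_def edgesH)
  have copy_id: "copy u = u" if "u \<in> edges ?H" for u
    using that by (auto simp: copy_def edgesH)
  have copy_tri: "copy d = a" "copy e = b" "copy f = c"
    using neq by (auto simp: copy_def)

  have r_in: "r D \<in> topspace (decoration_space ?H)"
    if D: "D \<in> topspace (decoration_space G)" for D
  proof -
    have "D \<in> edges G \<rightarrow> CP2_points" "admissible G D"
      using D by (auto simp: topspace PiE_iff)
    moreover have "admissible ?H (r D) \<longleftrightarrow> admissible ?H D"
      by (rule admissible_cong) (simp add: r_def)
    ultimately show ?thesis
      using adm by (auto simp: topspace r_def edgesH)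
  qed
  have s_in: "s D \<in> topspace (decoration_space G)"
    if D: "D \<in> topspace (decoration_space ?H)" for D
  proof -
    have DH: "D \<in> edges ?H \<rightarrow> CP2_points" "admissible ?H D"
      using D by (auto simp: topspace PiE_iff)
    then have sD: "s D \<in> edges G \<rightarrow>\<^sub>E CP2_points"
      using copy_in by (auto simp: s_def)
    moreover have "admissible ?H (s D) \<longleftrightarrow> admissible ?H D"
      by (rule admissible_cong) (simp add: s_def copy_id, simp add: edgesH)
    \<comment> \<open>Since \<open>copy\<close> fixes \<open>a\<close>, both sides of the first
      equation are \<open>D a\<close>; similarly for \<open>b\<close> and \<open>c\<close>.\<close>
    moreover have "s D d = s D a" "s D e = s D b" "s D f = s D c"
      using def_in abc copy_id[of a] copy_id[of b] copy_id[of c]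
      by (auto simp: s_def copy_tri edgesH)
    ultimately show ?thesis
      using adm[of "s D"] DH by (auto simp: topspace PiE_iff)
  qed
  have "continuous_map (decoration_space G) (decoration_space ?H) r"
    by (rule into) (use proj[of _ G] r_in in \<open>auto simp: r_def edgesH\<close>)
  moreover have "continuous_map (decoration_space ?H) (decoration_space G) s"
    by (rule into) (use proj[of _ ?H] copy_in s_in in \<open>auto simp: s_def\<close>)
  moreover have "s (r D) = D" if D: "D \<in> topspace (decoration_space G)" for D
  proof -
    have DG: "D \<in> edges G \<rightarrow>\<^sub>E CP2_points" "admissible G D"
      using D by (auto simp: topspace)
    then have "D d = D a" "D e = D b" "D f = D c"
      using adm[of D] by (auto simp: PiE_iff)
    \<comment> \<open>An admissible \<open>D\<close> takes equal values on each triangle edge and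
      the outer edge it is copied from, so pulling back along \<open>copy\<close> leaves
      \<open>D\<close> unchanged.\<close>
    then have "D (copy u) = D u" for u
      by (simp add: copy_def)
    then have "s (r D) u = D u" for u
      using DG(1) copy_in by (auto simp: s_def r_def PiE_iff extensional_def)
    then show ?thesis
      by blast
  qed
  moreover have "r (s D) = D" if D: "D \<in> topspace (decoration_space ?H)" for D
  proof
    fix u
    \<comment> \<open>Off the edges of \<open>?H\<close> both sides are \<open>undefined\<close>; on
      them \<open>copy\<close> is the identity.\<close>
    have "D \<in> extensional (edges ?H)"
      using D by (auto simp: topspace PiE_iff)
    then show "r (s D) u = D u"
      using copy_id[of u] by (auto simp: r_def s_def extensional_def edgesH)
  qed
  ultimately have "homeomorphic_maps (decoration_space G) (decoration_space ?H) r s"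
    by (simp add: homeomorphic_maps_def)
  then show ?thesis
    by (rule homeomorphic_maps_imp_homeomorphic_space)
qed

end
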